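(* There exists an absolute constant $c>0$ such that for every $n\ge 1$ and every centered log-concave probability measure $\mu$ on $\mathbb{R}^n$, $$\int_{\mathbb{R}^n}\exp\left(\frac{c}{n}\Lambda_{\mu}^{\ast}(x)\right)\,d\mu(x)<\infty .$$ In particular, $\Lambda_{\mu}^{\ast}$ has finite moments of all orders with respect to $\mu$.
   Context: A Borel probability measure $\mu$ on $\mathbb{R}^n$ is called log-concave if $\mu(H)<1$ for every hyperplane $H$ of $\mathbb{R}^n$ and $\mu(\lambda A+(1-\lambda)B)\ge \mu(A)^{\lambda}\mu(B)^{1-\lambda}$ for all compact sets $A,B\subset\mathbb{R}^n$ and all $\lambda\in(0,1)$; such a $\mu$ has a log-concave density $f_\mu$ with respect to Lebesgue measure. It is centered if its barycenter is the origin, i.e. $\int\langle x,\xi\rangle\,d\mu(x)=0$ for all $\xi$. The log-Laplace transform is $\Lambda_\mu(\xi)=\ln\left(\int_{\mathbb{R}^n}e^{\langle\xi,z\rangle}\,d\mu(z)\right)$ and the Cramér transform of $\mu$ is its Legendre transform $\Lambda_\mu^\ast(x)=\sup_{\xi\in\mathbb{R}^n}\{\langle x,\xi\rangle-\Lambda_\mu(\xi)\}$. "Absolute constant" means a constant independent of $n$ and $\mu$. *)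

theory Defs
  imports "HOL-Probability.Probability"
begin

text \<open>
  The dimension n is quantified inside the theorem (under the absolute constant), so R^n cannot be
  a type here. Vectors are functions on \<open>{..<n}\<close> in the sense of \<^const>\<open>PiE\<close>, with the library's
  product topology \<^term>\<open>powertop_real {..<n}\<close> and product sigma-algebra
  \<^term>\<open>PiM {..<n} (\<lambda>_. borel)\<close>, which are the Euclidean topology and its Borel sigma-algebra.
\<close>

definition vecs :: "nat \<Rightarrow> (nat \<Rightarrow> real) set" where
  "vecs n = {..<n} \<rightarrow>\<^sub>E UNIV"

definition ip :: "nat \<Rightarrow> (nat \<Rightarrow> real) \<Rightarrow> (nat \<Rightarrow> real) \<Rightarrow> real" where
  "ip n x y = (\<Sum>i<n. x i * y i)"

definition borel_prob :: "nat \<Rightarrow> (nat \<Rightarrow> real) measure \<Rightarrow> bool" where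
  "borel_prob n \<mu> \<longleftrightarrow> prob_space \<mu> \<and> sets \<mu> = sets (PiM {..<n} (\<lambda>_. borel))"

definition hyperplane :: "nat \<Rightarrow> (nat \<Rightarrow> real) set \<Rightarrow> bool" where
  "hyperplane n H \<longleftrightarrow> (\<exists>a\<in>vecs n. \<exists>b::real. (\<exists>i<n. a i \<noteq> 0) \<and> H = {x \<in> vecs n. ip n a x = b})"

definition mink_comb ::
  "nat \<Rightarrow> real \<Rightarrow> (nat \<Rightarrow> real) set \<Rightarrow> (nat \<Rightarrow> real) set \<Rightarrow> (nat \<Rightarrow> real) set" where
  "mink_comb n t A B = {(\<lambda>i\<in>{..<n}. t * a i + (1 - t) * b i) |a b. a \<in> A \<and> b \<in> B}"

definition log_concave :: "nat \<Rightarrow> (nat \<Rightarrow> real) measure \<Rightarrow> bool" where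
  "log_concave n \<mu> \<longleftrightarrow>
     borel_prob n \<mu> \<and>
     (\<forall>H. hyperplane n H \<longrightarrow> measure \<mu> H < 1) \<and>
     (\<forall>A B t. compactin (powertop_real {..<n}) A \<longrightarrow> compactin (powertop_real {..<n}) B \<longrightarrow>
        0 < t \<longrightarrow> t < 1 \<longrightarrow>
        measure \<mu> (mink_comb n t A B) \<ge> measure \<mu> A powr t * measure \<mu> B powr (1 - t))"

text \<open>Integrability is demanded because the Bochner integral is 0 on non-integrable functions.\<close>

definition centered :: "nat \<Rightarrow> (nat \<Rightarrow> real) measure \<Rightarrow> bool" where
  "centered n \<mu> \<longleftrightarrow>
     (\<forall>\<xi>\<in>vecs n. integrable \<mu> (\<lambda>x. ip n x \<xi>) \<and> (\<integral>x. ip n x \<xi> \<partial>\<mu>) = 0)"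

text \<open>Exponential, logarithm and powers with their usual values at the infinite end points.\<close>

definition exp_ext :: "ereal \<Rightarrow> ennreal" where
  "exp_ext x = (if x = \<infinity> then \<infinity> else if x = -\<infinity> then 0 else ennreal (exp (real_of_ereal x)))"

definition ln_ext :: "ennreal \<Rightarrow> ereal" where
  "ln_ext x = (if x = \<infinity> then \<infinity> else if x = 0 then -\<infinity> else ereal (ln (enn2real x)))"

definition powr_ext :: "ennreal \<Rightarrow> real \<Rightarrow> ennreal" where
  "powr_ext x p = (if x = \<infinity> then \<infinity> else ennreal (enn2real x powr p))" \<comment> \<open>for \<open>p > 0\<close>\<close>

definition log_laplace :: "nat \<Rightarrow> (nat \<Rightarrow> real) measure \<Rightarrow> (nat \<Rightarrow> real) \<Rightarrow> ereal" where
  "log_laplace n \<mu> \<xi> = ln_ext (\<integral>\<^sup>+ z. ennreal (exp (ip n \<xi> z)) \<partial>\<mu>)"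

definition cramer :: "nat \<Rightarrow> (nat \<Rightarrow> real) measure \<Rightarrow> (nat \<Rightarrow> real) \<Rightarrow> ereal" where
  "cramer n \<mu> x = (SUP \<xi>\<in>vecs n. ereal (ip n x \<xi>) - log_laplace n \<mu> \<xi>)"

end

theory Submission
  imports Defs
begin

text \<open>
  If every half-space through \<open>x\<close> has measure at least \<open>q\<close>, then \<open>cramer n \<mu> x \<le> - ln q\<close>,
  so it suffices to bound the measure of the points of small half-space depth; no density is needed.
  Call \<open>y\<close> heavy at scale \<open>r\<close> if the cube of radius \<open>r\<close> about \<open>y\<close> has measure at
  least \<open>r ^ (2 * n + 1)\<close>. Covering a cube of radius \<open>1 / r\<close> by \<open>O(r ^ (- 2 * n))\<close> small cubes
  shows that all but \<open>O(r)\<close> of the mass lies in a compact set \<open>K\<close> of heavy points. For a small cube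
  \<open>B\<close> about the origin, whose points are uniformly deep, a half-space meeting \<open>(1 - O(r)) K + O(r) B\<close>
  contains either a deep half-space or the cube of radius \<open>r\<close> about a heavy point.
  Log-concavity gives \<open>\<mu> ((1 - O(r)) K + O(r) B) \<ge> 1 - O(r)\<close>. Hence the Cramer transform exceeds
  \<open>(2 * n + 1) ln (1 / r)\<close> only with probability \<open>O(r)\<close>.
\<close>

section \<open>Cubes and the inner product\<close>

text \<open>The closed ball of the sup norm. The centre is read only at indices below
  \<open>n\<close>, so it need not lie in \<open>vecs n\<close>; the constant function 0 serves as
  the origin.\<close>

definition cube :: "nat \<Rightarrow> (nat \<Rightarrow> real) \<Rightarrow> real \<Rightarrow> (nat \<Rightarrow> real) set" where
  "cube n x r = PiE {..<n} (\<lambda>i. {x i - r..x i + r})"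

lemma compactin_cube: "compactin (powertop_real {..<n}) (cube n x r)"
  unfolding cube_def compactin_PiE by simp

lemma cube_subset_vecs: "cube n x r \<subseteq> vecs n"
  by (auto simp: cube_def vecs_def)

lemma cube_nth: "z \<in> cube n x r \<Longrightarrow> i < n \<Longrightarrow> \<bar>z i - x i\<bar> \<le> r"
  using PiE_mem[of z "{..<n}" "\<lambda>i. {x i - r..x i + r}" i] by (simp add: cube_def abs_le_iff)

lemma cubeI: "z \<in> vecs n \<Longrightarrow> (\<And>i. i < n \<Longrightarrow> \<bar>z i - x i\<bar> \<le> r) \<Longrightarrow> z \<in> cube n x r"
  by (fastforce simp: cube_def vecs_def PiE_iff abs_le_iff)

lemma mink_comb_cube_subset:
  assumes "0 \<le> t" "t \<le> 1"
  shows "mink_comb n t (cube n x r) (cube n y s) \<subseteq>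
    cube n (\<lambda>i. t * x i + (1 - t) * y i) (t * r + (1 - t) * s)"
proof
  fix z assume "z \<in> mink_comb n t (cube n x r) (cube n y s)"
  then obtain a b where z: "z = (\<lambda>i\<in>{..<n}. t * a i + (1 - t) * b i)"
    and a: "a \<in> cube n x r" and b: "b \<in> cube n y s"
    by (auto simp: mink_comb_def)
  show "z \<in> cube n (\<lambda>i. t * x i + (1 - t) * y i) (t * r + (1 - t) * s)"
  proof (rule cubeI)
    show "z \<in> vecs n" by (simp add: z vecs_def)
    fix i assume i: "i < n"
    have "z i - (t * x i + (1 - t) * y i) = t * (a i - x i) + (1 - t) * (b i - y i)"
      using i by (simp add: z algebra_simps)
    also have "\<bar>\<dots>\<bar> \<le> t * \<bar>a i - x i\<bar> + (1 - t) * \<bar>b i - y i\<bar>"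
      using assms abs_triangle_ineq[of "t * (a i - x i)" "(1 - t) * (b i - y i)"] by (simp add: abs_mult)
    also have "\<dots> \<le> t * r + (1 - t) * s"
      using assms cube_nth[OF a i] cube_nth[OF b i] by (intro add_mono mult_left_mono) auto
    finally show "\<bar>z i - (t * x i + (1 - t) * y i)\<bar> \<le> t * r + (1 - t) * s" .
  qed
qed

lemma ip_commute: "ip n x y = ip n y x"
  by (simp add: ip_def mult.commute)

lemma ip_linear: "ip n (\<lambda>i\<in>{..<n}. s * x i + t * y i) \<xi> = s * ip n x \<xi> + t * ip n y \<xi>"
  by (simp add: ip_def sum.distrib sum_distrib_left algebra_simps)

text \<open>Duality of the sup norm and the l1 norm. Because of it, half-spaces with normal \<xi>
  are shifted by multiples of the l1 norm of \<xi> throughout.\<close>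

lemma ip_cube_bound:
  assumes "z \<in> cube n x r"
  shows "\<bar>ip n z \<xi> - ip n x \<xi>\<bar> \<le> r * (\<Sum>i<n. \<bar>\<xi> i\<bar>)"
proof -
  have "\<bar>ip n z \<xi> - ip n x \<xi>\<bar> = \<bar>\<Sum>i<n. (z i - x i) * \<xi> i\<bar>"
    by (simp add: ip_def sum_subtractf algebra_simps)
  also have "\<dots> \<le> (\<Sum>i<n. \<bar>(z i - x i) * \<xi> i\<bar>)" by (rule sum_abs)
  also have "\<dots> \<le> (\<Sum>i<n. r * \<bar>\<xi> i\<bar>)"
    using cube_nth[OF assms] by (intro sum_mono) (auto simp: abs_mult intro!: mult_right_mono)
  finally show ?thesis by (simp add: sum_distrib_left)
qed

section \<open>Measurability and integrability for a fixed measure\<close>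

locale centered_log_concave =
  fixes n :: nat and \<mu> :: "(nat \<Rightarrow> real) measure"
  assumes n_pos: "n \<ge> 1" and lc: "log_concave n \<mu>" and cen: "centered n \<mu>"
begin

lemma prob_space_mu: "prob_space \<mu>"
  using lc by (simp add: log_concave_def borel_prob_def)

sublocale prob_space \<mu>
  by (rule prob_space_mu)

lemma sets_mu: "sets \<mu> = sets (PiM {..<n} (\<lambda>_. borel))"
  using lc by (simp add: log_concave_def borel_prob_def)

lemma space_mu: "space \<mu> = vecs n"
  using sets_eq_imp_space_eq[OF sets_mu] by (simp add: space_PiM vecs_def)

lemma coordinate_measurable [measurable]: "i < n \<Longrightarrow> (\<lambda>x. x i) \<in> borel_measurable \<mu>"
  unfolding measurable_cong_sets[OF sets_mu refl] by (rule measurable_component_singleton) simp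

lemma ip_measurable [measurable]: "(\<lambda>z. ip n z \<xi>) \<in> borel_measurable \<mu>"
  unfolding ip_def by measurable

lemma cube_sets [measurable]: "cube n x r \<in> sets \<mu>"
  unfolding cube_def sets_mu by (rule sets_PiM_I_finite) auto

lemma ip_restrict: "ip n z (restrict \<xi> {..<n}) = ip n z \<xi>"
  by (simp add: ip_def)

lemma ip_integrable: "integrable \<mu> (\<lambda>z. ip n z \<xi>)"
  and ip_integral: "(\<integral>z. ip n z \<xi> \<partial>\<mu>) = 0"
  using cen[unfolded centered_def, rule_format, of "restrict \<xi> {..<n}"]
  by (simp_all add: ip_restrict vecs_def)

lemma coordinate_integrable: "i < n \<Longrightarrow> integrable \<mu> (\<lambda>z. z i)"
  using ip_integrable[of "\<lambda>j. if j = i then 1 else 0"]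
  by (simp add: ip_def if_distrib cong: if_cong)

lemma l1_integrable: "integrable \<mu> (\<lambda>z. \<Sum>i<n. \<bar>z i - x i\<bar>)"
  using coordinate_integrable by (intro Bochner_Integration.integrable_sum integrable_abs
      Bochner_Integration.integrable_diff) auto

lemma measure_mink_comb:
  assumes "compactin (powertop_real {..<n}) A" "compactin (powertop_real {..<n}) B" "0 < t" "t < 1"
  shows "measure \<mu> A powr t * measure \<mu> B powr (1 - t) \<le> measure \<mu> (mink_comb n t A B)"
  using lc assms by (auto simp: log_concave_def)

section \<open>Uniform depth near the origin\<close>

text \<open>If the positive part vanished almost everywhere, so would the whole linear form, since
  its mean is 0; all mass would then lie on a hyperplane through the origin. Truncating at 1 gives a
  bounded integrand, so that the mean depends continuously on \<xi>.\<close>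

lemma positive_part_mean_pos:
  assumes "i < n" "\<xi> i \<noteq> 0"
  shows "0 < (\<integral>z. min 1 (max 0 (ip n z \<xi>)) \<partial>\<mu>)"
proof (rule ccontr)
  assume neg: "\<not> 0 < (\<integral>z. min 1 (max 0 (ip n z \<xi>)) \<partial>\<mu>)"
  have int: "integrable \<mu> (\<lambda>z. min 1 (max 0 (ip n z \<xi>)))"
    by (rule integrable_const_bound[where B = 1]) auto
  have "0 \<le> (\<integral>z. min 1 (max 0 (ip n z \<xi>)) \<partial>\<mu>)"
    by (rule integral_nonneg_AE) auto
  with neg have "(\<integral>z. min 1 (max 0 (ip n z \<xi>)) \<partial>\<mu>) = 0" by simp
  then have "AE z in \<mu>. min 1 (max 0 (ip n z \<xi>)) = 0"
    by (subst (asm) integral_nonneg_eq_0_iff_AE[OF int]) auto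
  then have le: "AE z in \<mu>. 0 \<le> - ip n z \<xi>"
    by eventually_elim (auto simp: min_def max_def split: if_splits)
  have "(\<integral>z. - ip n z \<xi> \<partial>\<mu>) = 0" by (simp add: ip_integral)
  with le have "AE z in \<mu>. - ip n z \<xi> = 0"
    by (subst (asm) integral_nonneg_eq_0_iff_AE) (auto intro: ip_integrable)
  then have ae: "AE z in \<mu>. ip n (restrict \<xi> {..<n}) z = 0"
    by (simp add: ip_commute[of n _ z for z] ip_restrict)
  let ?H = "{z \<in> vecs n. ip n (restrict \<xi> {..<n}) z = 0}"
  have "hyperplane n ?H"
    unfolding hyperplane_def using assms
    by (intro bexI[of _ "restrict \<xi> {..<n}"] exI[of _ 0]) (auto simp: vecs_def)
  then have "measure \<mu> ?H < 1" using lc by (auto simp: log_concave_def)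
  moreover have "measure \<mu> ?H = 1"
    using ae by (subst space_mu[symmetric], subst prob_Collect_eq_1)
      (simp_all add: ip_commute[of n _ z for z] ip_restrict)
  ultimately show False by simp
qed

text \<open>By homogeneity it is enough to treat the l1 unit sphere, where the mean of the truncated
  positive part attains a positive minimum by compactness. One number \<delta> serves both as a
  distance and as a lower bound for the mass.\<close>

lemma deep_origin:
  obtains \<delta> where "0 < \<delta>" "\<And>\<xi>. \<delta> \<le> prob {z \<in> space \<mu>. \<delta> * (\<Sum>i<n. \<bar>\<xi> i\<bar>) \<le> ip n z \<xi>}"
proof -
  define F where "F \<xi> = (\<integral>z. min 1 (max 0 (ip n z \<xi>)) \<partial>\<mu>)" for \<xi>
  have coord: "continuous_on UNIV (\<lambda>\<xi>::nat \<Rightarrow> real. \<xi> i)" for i by simp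
  have "(F \<circ> u) \<longlonglongrightarrow> F a" if u: "u \<longlonglongrightarrow> a" for u a
    unfolding comp_def F_def
  proof (rule integral_dominated_convergence[where w = "\<lambda>_. 1"])
    show "AE z in \<mu>. (\<lambda>k. min 1 (max 0 (ip n z (u k)))) \<longlonglongrightarrow> min 1 (max 0 (ip n z a))"
      unfolding ip_def
      by (intro AE_I2 tendsto_intros continuous_on_tendsto_compose[OF coord u]) auto
  qed auto
  then have F_cont: "continuous_on UNIV F"
    by (auto simp: continuous_on_sequentially)
  \<comment> \<open>The l1 unit sphere of R^n, extended by 0 so that it is a compact subset of the
    type \<open>nat \<Rightarrow> real\<close>.\<close>
  define S :: "(nat \<Rightarrow> real) set" where
    "S = PiE UNIV (\<lambda>i. if i < n then {-1..1} else {0}) \<inter> {\<xi>. (\<Sum>i<n. \<bar>\<xi> i\<bar>) = 1}"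
  have "compactin (powertop_real UNIV) (PiE UNIV (\<lambda>i. if i < n then {-1..1} else {0::real}))"
    unfolding compactin_PiE by auto
  then have "compact (PiE UNIV (\<lambda>i. if i < n then {-1..1} else {0::real}))"
    by (simp add: euclidean_product_topology)
  moreover have "closed {\<xi>::nat \<Rightarrow> real. (\<Sum>i<n. \<bar>\<xi> i\<bar>) = 1}"
    by (intro closed_Collect_eq continuous_intros) auto
  ultimately have S_compact: "compact S" unfolding S_def by (rule compact_Int_closed)
  have "(\<lambda>i. if i = 0 then 1 else 0) \<in> S"
    using n_pos by (auto simp: S_def PiE_iff if_distrib cong: if_cong)
  then have "S \<noteq> {}" by blast
  from continuous_attains_inf[OF S_compact this continuous_on_subset[OF F_cont subset_UNIV]]
  obtain \<xi>0 where \<xi>0: "\<xi>0 \<in> S" and min: "\<And>\<xi>. \<xi> \<in> S \<Longrightarrow> F \<xi>0 \<le> F \<xi>" by blast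
  have "\<exists>i<n. \<xi>0 i \<noteq> 0"
  proof (rule ccontr)
    assume "\<not> (\<exists>i<n. \<xi>0 i \<noteq> 0)"
    then have "(\<Sum>i<n. \<bar>\<xi>0 i\<bar>) = 0" by simp
    then show False using \<xi>0 by (simp add: S_def)
  qed
  then have pos: "0 < F \<xi>0" unfolding F_def using positive_part_mean_pos by blast
  \<comment> \<open>The truncated form is at most \<delta> plus the indicator of the set where the
    form is at least \<delta>, so a mean of \<open>2 * \<delta>\<close> leaves mass \<delta> for
    that set. The bound by 1 covers the degenerate normal, whose half-space is everything.\<close>
  define \<delta> where "\<delta> = min 1 (F \<xi>0 / 2)"
  have \<delta>: "0 < \<delta>" "\<delta> \<le> 1" "2 * \<delta> \<le> F \<xi>0" using pos by (auto simp: \<delta>_def)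
  show ?thesis
  proof (rule that[OF \<delta>(1)])
    fix \<xi> :: "nat \<Rightarrow> real"
    define L where "L = (\<Sum>i<n. \<bar>\<xi> i\<bar>)"
    have L: "0 \<le> L" by (simp add: L_def sum_nonneg)
    show "\<delta> \<le> prob {z \<in> space \<mu>. \<delta> * (\<Sum>i<n. \<bar>\<xi> i\<bar>) \<le> ip n z \<xi>}"
    proof (cases "L = 0")
      case True
      then have "\<forall>i\<in>{..<n}. \<bar>\<xi> i\<bar> = 0"
        unfolding L_def by (subst (asm) sum_nonneg_eq_0_iff) auto
      then have "ip n z \<xi> = 0" for z by (simp add: ip_def)
      then show ?thesis using \<delta> True by (simp add: L_def prob_space)
    next
      case False
      then have L: "0 < L" using L by simp
      define \<zeta> where "\<zeta> i = (if i < n then \<xi> i / L else 0)" for i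
      have "\<bar>\<xi> i\<bar> \<le> L" if "i < n" for i
        unfolding L_def using that by (intro member_le_sum) auto
      then have "- L \<le> \<xi> i" "\<xi> i \<le> L" if "i < n" for i
        using that by (fastforce simp: abs_le_iff)+
      then have "\<zeta> \<in> S"
        using L by (auto simp: S_def PiE_iff \<zeta>_def field_simps L_def[symmetric]
            simp flip: sum_divide_distrib)
      then have "2 * \<delta> \<le> F \<zeta>" using min \<delta> by fastforce
      also have "F \<zeta> \<le> (\<integral>z. \<delta> + indicator {z \<in> space \<mu>. \<delta> \<le> ip n z \<zeta>} z \<partial>\<mu>)"
        unfolding F_def
      proof (rule integral_mono)
        show "integrable \<mu> (\<lambda>z. min 1 (max 0 (ip n z \<zeta>)))"
          by (rule integrable_const_bound[where B = 1]) auto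
        show "integrable \<mu> (\<lambda>z. \<delta> + indicator {z \<in> space \<mu>. \<delta> \<le> ip n z \<zeta>} z)"
          by (intro Bochner_Integration.integrable_add integrable_const integrable_real_indicator)
            (auto simp: emeasure_eq_measure)
      qed (use \<delta> in \<open>auto simp: indicator_def\<close>)
      also have "\<dots> = \<delta> + prob {z \<in> space \<mu>. \<delta> \<le> ip n z \<zeta>}"
        by (subst Bochner_Integration.integral_add) (auto simp: prob_space emeasure_eq_measure)
      also have "{z \<in> space \<mu>. \<delta> \<le> ip n z \<zeta>} = {z \<in> space \<mu>. \<delta> * (\<Sum>i<n. \<bar>\<xi> i\<bar>) \<le> ip n z \<xi>}"
      proof -
        have "ip n z \<zeta> = ip n z \<xi> / L" for z by (simp add: ip_def \<zeta>_def sum_divide_distrib)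
        then show ?thesis using L by (simp add: pos_le_divide_eq L_def[symmetric])
      qed
      finally show ?thesis by simp
    qed
  qed
qed


section \<open>Heavy points\<close>

text \<open>Cut the large cube into grid cells of side \<open>r\<close> and keep those of mass at
  least \<eta>. The cell of a point lies in the cube of radius \<open>r\<close> about that point, so
  all points of the kept cells are heavy; each discarded cell loses less than \<eta>.\<close>

lemma heavy_compact:
  assumes r: "0 < r" and \<eta>: "0 \<le> \<eta>"
  obtains K where "compactin (powertop_real {..<n}) K" "K \<in> sets \<mu>"
    "\<And>z. z \<in> K \<Longrightarrow> \<eta> \<le> prob (cube n z r)"
    "prob (cube n (\<lambda>_. 0) (real N * r)) - real (2 * N + 1) ^ n * \<eta> \<le> prob K"
proof -
  \<comment> \<open>The index \<open>N\<close> occurs because a coordinate equal to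
    \<open>N * r\<close> has floor \<open>N\<close>; this gives \<open>2 * N + 1\<close> cells per
    direction.\<close>
  define I where "I = ({..<n} \<rightarrow>\<^sub>E {- int N..int N})"
  define Q where "Q k = cube n (\<lambda>i. (of_int (k i) + 1/2) * r) (r / 2)" for k :: "nat \<Rightarrow> int"
  define G where "G = {k \<in> I. \<eta> \<le> prob (Q k)}"
  define K where "K = (\<Union>k\<in>G. Q k)"
  have fin: "finite I" unfolding I_def by (intro finite_PiE) auto
  have card: "card I = (2 * N + 1) ^ n"
    unfolding I_def by (subst card_PiE) (auto simp: nat_add_distrib nat_mult_distrib algebra_simps)
  have finG: "finite G" using fin by (simp add: G_def)
  have Qs: "Q k \<in> sets \<mu>" for k by (simp add: Q_def)
  show ?thesis
  proof (rule that[of K])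
    show "compactin (powertop_real {..<n}) K"
      unfolding K_def using finG by (intro compactin_Union) (auto simp: Q_def compactin_cube)
    show Ks: "K \<in> sets \<mu>" unfolding K_def using finG Qs by auto
    show "\<eta> \<le> prob (cube n z r)" if "z \<in> K" for z
    proof -
      from that obtain k where k: "k \<in> G" "z \<in> Q k" by (auto simp: K_def)
      have "Q k \<subseteq> cube n z r"
      proof
        fix w assume w: "w \<in> Q k"
        show "w \<in> cube n z r"
        proof (rule cubeI)
          show "w \<in> vecs n" using w cube_subset_vecs by (auto simp: Q_def)
          fix i assume "i < n"
          then show "\<bar>w i - z i\<bar> \<le> r"
            using cube_nth[OF w[unfolded Q_def], of i] cube_nth[OF k(2)[unfolded Q_def], of i] by linarith
        qed
      qed
      then have "prob (Q k) \<le> prob (cube n z r)" by (intro finite_measure_mono) auto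
      then show ?thesis using k by (simp add: G_def)
    qed
    have "cube n (\<lambda>_. 0) (real N * r) \<subseteq> K \<union> (\<Union>k\<in>I - G. Q k)"
    proof
      fix z assume z: "z \<in> cube n (\<lambda>_. 0) (real N * r)"
      define k where "k = (\<lambda>i\<in>{..<n}. \<lfloor>z i / r\<rfloor>)"
      have "k \<in> I"
      proof -
        have "- int N \<le> \<lfloor>z i / r\<rfloor> \<and> \<lfloor>z i / r\<rfloor> \<le> int N" if "i < n" for i
        proof -
          have "- real N \<le> z i / r" "z i / r \<le> real N"
            using cube_nth[OF z that] r by (auto simp: field_simps abs_le_iff)
          then show ?thesis by linarith
        qed
        then show ?thesis by (auto simp: I_def k_def)
      qed
      moreover have "z \<in> Q k" unfolding Q_def
      proof (rule cubeI)
        show "z \<in> vecs n" using z cube_subset_vecs by auto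
        fix i assume i: "i < n"
        have "of_int \<lfloor>z i / r\<rfloor> \<le> z i / r" "z i / r \<le> of_int \<lfloor>z i / r\<rfloor> + 1" by linarith+
        from iffD1[OF pos_le_divide_eq[OF r] this(1)] iffD1[OF pos_divide_le_eq[OF r] this(2)]
        have "of_int \<lfloor>z i / r\<rfloor> * r \<le> z i" "z i \<le> (of_int \<lfloor>z i / r\<rfloor> + 1) * r" .
        moreover have "(of_int \<lfloor>z i / r\<rfloor> + 1) * r = of_int \<lfloor>z i / r\<rfloor> * r + r"
          "(of_int (k i) + 1/2) * r = of_int \<lfloor>z i / r\<rfloor> * r + r / 2"
          using i by (simp_all add: k_def algebra_simps)
        ultimately show "\<bar>z i - (of_int (k i) + 1/2) * r\<bar> \<le> r / 2" by linarith
      qed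
      ultimately show "z \<in> K \<union> (\<Union>k\<in>I - G. Q k)" by (auto simp: K_def)
    qed
    then have "prob (cube n (\<lambda>_. 0) (real N * r)) \<le> prob (K \<union> (\<Union>k\<in>I - G. Q k))"
      using Ks Qs fin by (intro finite_measure_mono) auto
    also have "\<dots> \<le> prob K + prob (\<Union>k\<in>I - G. Q k)"
      using Ks Qs fin by (intro measure_Un_le) auto
    also have "prob (\<Union>k\<in>I - G. Q k) \<le> (\<Sum>k\<in>I - G. prob (Q k))"
      using Qs fin by (intro finite_measure_subadditive_finite) auto
    also have "\<dots> \<le> real (card (I - G)) * \<eta>"
      by (intro sum_bounded_above) (auto simp: G_def)
    also have "\<dots> \<le> real (card I) * \<eta>"
      using \<eta> fin by (intro mult_right_mono) (auto intro: card_mono)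
    finally show "prob (cube n (\<lambda>_. 0) (real N * r)) - real (2 * N + 1) ^ n * \<eta> \<le> prob K"
      by (simp add: card)
  qed
qed

definition l1_mean :: real where "l1_mean = (\<integral>z. (\<Sum>i<n. \<bar>z i\<bar>) \<partial>\<mu>)"

lemma l1_mean_nonneg: "0 \<le> l1_mean"
  unfolding l1_mean_def by (intro integral_nonneg_AE) (auto intro: sum_nonneg)

lemma prob_cube_ge:
  assumes "0 < R"
  shows "1 - l1_mean / R \<le> prob (cube n (\<lambda>_. 0) R)"
proof -
  have "prob (space \<mu> - cube n (\<lambda>_. 0) R) \<le> prob {z \<in> space \<mu>. R \<le> (\<Sum>i<n. \<bar>z i\<bar>)}"
  proof (rule finite_measure_mono)
    show "space \<mu> - cube n (\<lambda>_. 0) R \<subseteq> {z \<in> space \<mu>. R \<le> (\<Sum>i<n. \<bar>z i\<bar>)}"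
    proof safe
      fix z assume z: "z \<in> space \<mu>" "z \<notin> cube n (\<lambda>_. 0) R"
      show "R \<le> (\<Sum>i<n. \<bar>z i\<bar>)"
      proof (rule ccontr)
        assume *: "\<not> R \<le> (\<Sum>i<n. \<bar>z i\<bar>)"
        have "\<bar>z i\<bar> \<le> (\<Sum>i<n. \<bar>z i\<bar>)" if "i < n" for i
          using that by (intro member_le_sum) auto
        then have "\<bar>z i - 0\<bar> \<le> R" if "i < n" for i
          using * that by fastforce
        then have "z \<in> cube n (\<lambda>_. 0) R"
          using z by (intro cubeI) (auto simp: space_mu)
        with z show False by simp
      qed
    qed
  qed measurable
  also have "\<dots> \<le> l1_mean / R"
    unfolding l1_mean_def using l1_integrable[of "\<lambda>_. 0"] assms
    by (intro integral_Markov_inequality_measure[where A = "space \<mu>"]) (auto intro: sum_nonneg)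
  finally show ?thesis by (simp add: prob_compl)
qed

text \<open>Apply \<open>heavy_compact\<close> to cubes of radius \<open>Suc m * r\<close>. The
  threshold \<open>\<eta> m\<close> makes the discarded cells lose at most \<open>1 / Suc m\<close>,
  and Markov's inequality bounds the mass outside the cube by a multiple of the same, so the sets
  \<open>K m\<close> exhaust the measure.\<close>

lemma AE_heavy:
  assumes r: "0 < r"
  shows "AE z in \<mu>. 0 < prob (cube n z r)"
proof -
  define \<eta> where "\<eta> m = 1 / (real (2 * Suc m + 1) ^ n * real (Suc m))" for m
  have \<eta>: "0 < \<eta> m" for m by (simp add: \<eta>_def)
  have "\<exists>K. K \<in> sets \<mu> \<and> (\<forall>z\<in>K. \<eta> m \<le> prob (cube n z r)) \<and>
      1 - (l1_mean / r + 1) / real (Suc m) \<le> prob K" for m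
  proof -
    obtain K where K: "K \<in> sets \<mu>" "\<And>z. z \<in> K \<Longrightarrow> \<eta> m \<le> prob (cube n z r)"
      "prob (cube n (\<lambda>_. 0) (real (Suc m) * r)) - real (2 * Suc m + 1) ^ n * \<eta> m \<le> prob K"
      using heavy_compact[OF r less_imp_le[OF \<eta>[of m]], of "Suc m"] by metis
    have "real (2 * Suc m + 1) ^ n * \<eta> m = 1 / real (Suc m)"
      unfolding \<eta>_def by (simp del: of_nat_Suc of_nat_add of_nat_mult)
    then have "1 - (l1_mean / r + 1) / real (Suc m) \<le> prob K"
      using K(3) prob_cube_ge[of "real (Suc m) * r"] r by (simp add: add_divide_distrib mult.commute)
    with K show ?thesis by auto
  qed
  then obtain K where K: "\<And>m. K m \<in> sets \<mu>" "\<And>m z. z \<in> K m \<Longrightarrow> \<eta> m \<le> prob (cube n z r)"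
    "\<And>m. 1 - (l1_mean / r + 1) / real (Suc m) \<le> prob (K m)"
    by metis
  have "1 \<le> prob (\<Union>m. K m)"
  proof (rule LIMSEQ_le_const2)
    have "(\<lambda>m. 1 - (l1_mean / r + 1) / real (Suc m)) \<longlonglongrightarrow> 1 - 0"
      by (intro tendsto_diff tendsto_const LIMSEQ_Suc[OF lim_const_over_n])
    then show "(\<lambda>m. 1 - (l1_mean / r + 1) / real (Suc m)) \<longlonglongrightarrow> 1" by simp
    have "prob (K m) \<le> prob (\<Union>m. K m)" for m
      using K(1) by (intro finite_measure_mono) auto
    with K(3) show "\<exists>N. \<forall>m\<ge>N. 1 - (l1_mean / r + 1) / real (Suc m) \<le> prob (\<Union>m. K m)"
      by (meson order_trans)
  qed
  then have "prob (\<Union>m. K m) = 1" using prob_le_1 by (intro antisym) auto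
  then have "AE z in \<mu>. z \<in> (\<Union>m. K m)" using K(1) by (subst (asm) prob_eq_1) auto
  then show ?thesis
    by eventually_elim (use K(2) \<eta> in \<open>force intro: less_le_trans\<close>)
qed

text \<open>A convex combination of two cubes of equal radius lies in the cube of that radius about
  the combined centre, and log-concavity keeps its mass positive.\<close>

lemma heavy_convex:
  assumes x: "0 < prob (cube n x r)" and y: "0 < prob (cube n y r)" and t: "0 < t" "t < 1"
  shows "0 < prob (cube n (\<lambda>i\<in>{..<n}. t * x i + (1 - t) * y i) r)"
proof -
  have "0 < prob (cube n x r) powr t * prob (cube n y r) powr (1 - t)" using x y by simp
  also have "\<dots> \<le> prob (mink_comb n t (cube n x r) (cube n y r))"
    using t by (intro measure_mink_comb compactin_cube)
  also have "\<dots> \<le> prob (cube n (\<lambda>i. t * x i + (1 - t) * y i) (t * r + (1 - t) * r))"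
    using t by (intro finite_measure_mono mink_comb_cube_subset) auto
  also have "cube n (\<lambda>i. t * x i + (1 - t) * y i) (t * r + (1 - t) * r) =
      cube n (\<lambda>i\<in>{..<n}. t * x i + (1 - t) * y i) r"
    unfolding cube_def by (intro PiE_cong) (simp add: algebra_simps)
  finally show ?thesis .
qed

text \<open>The heavy points form a convex set of full measure, so a point of it that almost minimises
  the Euclidean norm almost separates it from the origin. As the barycenter is the origin,
  this forces the infimum of the norms to be 0.\<close>

lemma heavy_origin:
  assumes r: "0 < r"
  shows "0 < prob (cube n (\<lambda>_. 0) r)"
proof -
  \<comment> \<open>Half the radius, so that the \<rho>-cube about a heavy point of norm below
    \<rho> fits into the cube of radius \<open>r\<close> about the origin.\<close>
  define \<rho> where "\<rho> = r / 2"
  define q where "q p = (\<Sum>i<n. (p i)\<^sup>2)" for p :: "nat \<Rightarrow> real"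
  define D where "D = {z \<in> vecs n. 0 < prob (cube n z \<rho>)}"
  define d where "d = Inf (q ` D)"
  have \<rho>: "0 < \<rho>" using r by (simp add: \<rho>_def)
  have q0: "0 \<le> q p" for p by (simp add: q_def sum_nonneg)
  have aeD: "AE z in \<mu>. z \<in> D"
    using AE_heavy[OF \<rho>] AE_space by eventually_elim (simp add: D_def space_mu)
  then have "D \<noteq> {}" using AE_const[of False] by auto
  have bdd: "bdd_below (q ` D)" using q0 by (intro bdd_belowI[of _ 0]) auto
  have near: "\<exists>p\<in>D. q p < d + e" if "0 < e" for e
    using cInf_lessD[of "q ` D" "d + e"] that \<open>D \<noteq> {}\<close> by (auto simp: d_def)
  have d0: "0 \<le> d" unfolding d_def using \<open>D \<noteq> {}\<close> q0 by (intro cInf_greatest) auto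
  \<comment> \<open>The factor of \<open>s\<close> does not depend on \<open>s\<close>, so small
    \<open>s\<close> will force \<open>d = 0\<close>.\<close>
  have key: "d \<le> s * (1 + l1_mean + n * (2 + d))" if s: "0 < s" "s < 1" for s
  proof -
    obtain p where p: "p \<in> D" "q p < d + s\<^sup>2" using near[of "s\<^sup>2"] s by auto
    define w where "w z = (\<Sum>i<n. \<bar>z i - p i\<bar>)" for z
    have w0: "0 \<le> w z" for z by (simp add: w_def sum_nonneg)
    have ge: "0 \<le> ip n z p - q p + s * (1 + w z)" if z: "z \<in> D" for z
    proof -
      \<comment> \<open>The step from \<open>p\<close> towards \<open>z\<close> shrinks with their
        distance, so that \<open>t * w z \<le> s\<close>. The quadratic term then costs at most
        \<open>s\<^sup>2\<close>, the same as the excess of \<open>q p\<close> over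
        \<open>d\<close>; dividing by \<open>2 * t\<close> leaves a first-order inequality with an
        error linear in \<open>w z\<close>, hence integrable.\<close>
      define t where "t = s / (1 + w z)"
      have t: "0 < t" "t < 1" using s w0[of z] by (auto simp: t_def field_simps)
      have ts: "t * (1 + w z) = s" using w0[of z] by (simp add: t_def)
      have "(\<lambda>i\<in>{..<n}. t * z i + (1 - t) * p i) \<in> D"
        using heavy_convex[OF _ _ t, of z \<rho> p] z p by (auto simp: D_def vecs_def)
      then have "d \<le> q (\<lambda>i\<in>{..<n}. t * z i + (1 - t) * p i)"
        unfolding d_def by (intro cInf_lower bdd) auto
      also have "\<dots> = (\<Sum>i<n. (p i)\<^sup>2 + 2 * t * (z i * p i - (p i)\<^sup>2) + t\<^sup>2 * (z i - p i)\<^sup>2)"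
        unfolding q_def by (intro sum.cong) (auto simp: power2_eq_square algebra_simps)
      also have "\<dots> = q p + 2 * t * (ip n z p - q p) + t\<^sup>2 * (\<Sum>i<n. (z i - p i)\<^sup>2)"
        by (simp add: q_def ip_def sum.distrib sum_subtractf sum_distrib_left right_diff_distrib)
      also have "\<dots> \<le> q p + 2 * t * (ip n z p - q p) + t\<^sup>2 * (w z)\<^sup>2"
      proof -
        have "sqrt (\<Sum>i<n. (z i - p i)\<^sup>2) \<le> w z"
          using L2_set_le_sum_abs[of "\<lambda>i. z i - p i" "{..<n}"] by (simp add: L2_set_def w_def)
        then have "(\<Sum>i<n. (z i - p i)\<^sup>2) \<le> (w z)\<^sup>2" using w0 by (simp add: sqrt_le_D)
        then show ?thesis by (simp add: mult_left_mono)
      qed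
      also have "t\<^sup>2 * (w z)\<^sup>2 \<le> s\<^sup>2"
        unfolding power_mult_distrib[symmetric] using t w0[of z] ts
        by (intro power_mono) (auto simp: algebra_simps)
      finally have "0 \<le> 2 * t * (ip n z p - q p) + 2 * s\<^sup>2" using p(2) by simp
      also have "\<dots> = 2 * t * (ip n z p - q p + s * (1 + w z))"
        by (simp add: power2_eq_square algebra_simps flip: ts)
      finally show ?thesis using t by (simp add: zero_le_mult_iff)
    qed
    have w_int: "integrable \<mu> w" unfolding w_def by (rule l1_integrable)
    \<comment> \<open>Here centering enters: the linear term integrates to 0, leaving only
      \<open>- q p\<close> and the error.\<close>
    have "0 \<le> (\<integral>z. ip n z p - q p + s * (1 + w z) \<partial>\<mu>)"
      using aeD ge by (intro integral_nonneg_AE) auto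
    also have "\<dots> = s * (1 + (\<integral>z. w z \<partial>\<mu>)) - q p"
      using w_int ip_integrable by (simp add: ip_integral prob_space)
    finally have "q p \<le> s * (1 + (\<integral>z. w z \<partial>\<mu>))" by simp
    moreover have "(\<integral>z. w z \<partial>\<mu>) \<le> (\<integral>z. (\<Sum>i<n. \<bar>z i\<bar>) + n * (2 + d) \<partial>\<mu>)"
    proof (rule integral_mono[OF w_int])
      show "integrable \<mu> (\<lambda>z. (\<Sum>i<n. \<bar>z i\<bar>) + n * (2 + d))"
        using l1_integrable[of "\<lambda>_. 0"] by simp
      \<comment> \<open>The near-minimiser \<open>p\<close> varies with \<open>s\<close>; this bound
        makes the estimate of the mean of \<open>w\<close> uniform.\<close>
      have p_le: "\<bar>p i\<bar> \<le> 2 + d" if "i < n" for i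
      proof -
        have "(p i)\<^sup>2 \<le> q p" unfolding q_def using that by (intro member_le_sum) auto
        moreover have "\<bar>p i\<bar> \<le> 1 + (p i)\<^sup>2"
          using zero_le_power2[of "\<bar>p i\<bar> - 1"] by (simp add: power2_diff)
        moreover have "s\<^sup>2 \<le> 1" using s by (simp add: power_le_one)
        ultimately show ?thesis using p(2) by linarith
      qed
      have "w z \<le> (\<Sum>i<n. \<bar>z i\<bar> + (2 + d))" for z
        unfolding w_def by (intro sum_mono) (use p_le in fastforce)
      then show "w z \<le> (\<Sum>i<n. \<bar>z i\<bar>) + n * (2 + d)" for z by (simp add: sum.distrib)
    qed
    moreover have "(\<integral>z. (\<Sum>i<n. \<bar>z i\<bar>) + n * (2 + d) \<partial>\<mu>) = l1_mean + n * (2 + d)"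
      using l1_integrable[of "\<lambda>_. 0"] by (simp add: l1_mean_def prob_space)
    ultimately have "q p \<le> s * (1 + (l1_mean + n * (2 + d)))"
      using s by (smt (verit) mult_left_mono)
    moreover have "d \<le> q p" unfolding d_def using p(1) by (intro cInf_lower bdd) auto
    ultimately show ?thesis by (simp add: add.assoc)
  qed
  have "d \<le> 0"
  proof (rule ccontr)
    assume "\<not> d \<le> 0"
    then have d: "0 < d" by simp
    define B where "B = 1 + l1_mean + n * (2 + d)"
    have B: "1 \<le> B" using l1_mean_nonneg d by (simp add: B_def)
    define s where "s = min (1/2) (d / (2 * B))"
    have "0 < s" "s < 1" using d B by (auto simp: s_def)
    from key[OF this] have "d \<le> s * B" by (simp add: B_def)
    also have "\<dots> \<le> d / (2 * B) * B" using B by (intro mult_right_mono) (auto simp: s_def)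
    also have "\<dots> = d / 2" using B by simp
    finally show False using d by simp
  qed
  with d0 near[of "\<rho>\<^sup>2"] \<rho> obtain p where p: "p \<in> D" "q p < \<rho>\<^sup>2" by auto
  have p_le: "\<bar>p i\<bar> \<le> \<rho>" if "i < n" for i
  proof -
    have "(p i)\<^sup>2 \<le> q p" unfolding q_def using that by (intro member_le_sum) auto
    then have "(p i)\<^sup>2 \<le> \<rho>\<^sup>2" using p by simp
    then show ?thesis using \<rho> by (simp add: abs_le_square_iff[symmetric])
  qed
  have "cube n p \<rho> \<subseteq> cube n (\<lambda>_. 0) r"
  proof
    fix z assume z: "z \<in> cube n p \<rho>"
    show "z \<in> cube n (\<lambda>_. 0) r"
    proof (rule cubeI)
      show "z \<in> vecs n" using z cube_subset_vecs by auto
      fix i assume "i < n"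
      then show "\<bar>z i - 0\<bar> \<le> r" using cube_nth[OF z, of i] p_le[of i] unfolding \<rho>_def by linarith
    qed
  qed
  then have "prob (cube n p \<rho>) \<le> prob (cube n (\<lambda>_. 0) r)" by (intro finite_measure_mono) auto
  then show ?thesis using p by (simp add: D_def)
qed

section \<open>Measurability of the Cramer transform and its bound by half-space depth\<close>

text \<open>Members of \<open>vecs n\<close> are \<open>undefined\<close> from \<open>n\<close> on.
  Replacing those values by 0 lets open sets of the type \<open>nat \<Rightarrow> real\<close> be
  pulled back to \<mu>; \<open>ip n\<close> does not see the change.\<close>

lemma extension_vimage_sets:
  assumes "open U"
  shows "{x \<in> space \<mu>. (\<lambda>i. if i < n then x i else 0) \<in> U} \<in> sets \<mu>"
proof -
  have "(\<lambda>x i. if i < n then x i else 0) \<in> borel_measurable \<mu>"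
  proof (rule measurable_coordinatewise_then_product)
    show "(\<lambda>x. if i < n then x i else 0) \<in> borel_measurable \<mu>" for i
      by (cases "i < n") auto
  qed
  from measurable_sets[OF this borel_open[OF assms]] show ?thesis
    by (simp add: vimage_def Int_def conj_commute)
qed

text \<open>The supremum is uncountable, but its strict superlevel sets are open.\<close>

lemma cramer_measurable: "cramer n \<mu> \<in> borel_measurable \<mu>"
proof (rule borel_measurableI_greater)
  fix a
  define U where "U = (\<Union>\<xi>\<in>vecs n. {x. a < ereal (ip n x \<xi>) - log_laplace n \<mu> \<xi>})"
  have cont: "continuous_on UNIV (\<lambda>x::nat \<Rightarrow> real. ip n x \<xi>)" for \<xi>
    unfolding ip_def by (intro continuous_intros) auto
  have "open {x. a < ereal (ip n x \<xi>) - log_laplace n \<mu> \<xi>}" for \<xi>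
  proof (cases "log_laplace n \<mu> \<xi>")
    case (real l)
    have "continuous_on UNIV (\<lambda>x. ereal (ip n x \<xi> - l))"
      by (intro continuous_on_ereal continuous_intros cont)
    then show ?thesis using real by (simp add: open_Collect_less continuous_on_const)
  qed auto
  then have "open U" unfolding U_def by auto
  moreover have "{x \<in> space \<mu>. a < cramer n \<mu> x} =
      {x \<in> space \<mu>. (\<lambda>i. if i < n then x i else 0) \<in> U}"
    by (simp add: U_def cramer_def less_SUP_iff ip_def)
  ultimately show "{x \<in> space \<mu>. a < cramer n \<mu> x} \<in> sets \<mu>"
    using extension_vimage_sets by simp
qed

lemma cramer_nonneg: "0 \<le> cramer n \<mu> x"
proof -
  have "(\<lambda>i\<in>{..<n}. 0) \<in> vecs n" by (simp add: vecs_def)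
  moreover have "ereal (ip n x (\<lambda>i\<in>{..<n}. 0)) - log_laplace n \<mu> (\<lambda>i\<in>{..<n}. 0) = 0"
    by (simp add: ip_def log_laplace_def ln_ext_def emeasure_space_1 zero_ereal_def)
  ultimately show ?thesis unfolding cramer_def
    by (intro SUP_upper2[of "\<lambda>i\<in>{..<n}. 0"]) simp_all
qed

text \<open>Chernoff's bound: the exponential moment is at least the value of the exponential at
  \<open>x\<close> times the mass of the half-space beyond \<open>x\<close>. An infinite moment
  contributes minus infinity to the supremum.\<close>

lemma cramer_le:
  assumes q: "0 < q" and half: "\<And>\<xi>. q \<le> prob {z \<in> space \<mu>. ip n x \<xi> \<le> ip n z \<xi>}"
  shows "cramer n \<mu> x \<le> ereal (- ln q)"
  unfolding cramer_def
proof (rule SUP_least)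
  fix \<xi>
  define I where "I = (\<integral>\<^sup>+ z. ennreal (exp (ip n \<xi> z)) \<partial>\<mu>)"
  define H where "H = {z \<in> space \<mu>. ip n x \<xi> \<le> ip n z \<xi>}"
  have "ennreal (exp (ip n x \<xi>) * q) \<le> ennreal (exp (ip n x \<xi>)) * emeasure \<mu> H"
    using half[of \<xi>] q by (simp add: ennreal_mult' emeasure_eq_measure H_def mult_left_mono)
  also have "\<dots> = (\<integral>\<^sup>+ z. ennreal (exp (ip n x \<xi>)) * indicator H z \<partial>\<mu>)"
    by (subst nn_integral_cmult_indicator) (auto simp: H_def)
  also have "\<dots> \<le> I"
    unfolding I_def by (intro nn_integral_mono) (auto simp: H_def indicator_def ip_commute)
  finally have le: "ennreal (exp (ip n x \<xi>) * q) \<le> I" .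
  show "ereal (ip n x \<xi>) - log_laplace n \<mu> \<xi> \<le> ereal (- ln q)"
  proof (cases "I = \<infinity>")
    case True
    then show ?thesis by (simp add: log_laplace_def ln_ext_def I_def)
  next
    case False
    then obtain v where v: "I = ennreal v" "0 \<le> v" by (cases I) auto
    have *: "exp (ip n x \<xi>) * q \<le> v" using le v q by simp
    then have "0 < v" using q by (smt (verit) exp_gt_zero mult_pos_pos)
    have "ip n x \<xi> + ln q = ln (exp (ip n x \<xi>) * q)" using q by (simp add: ln_mult)
    also have "\<dots> \<le> ln v" using * q \<open>0 < v\<close> by (subst ln_le_cancel_iff) auto
    finally have "ip n x \<xi> - ln v \<le> - ln q" by simp
    then show ?thesis using False v \<open>0 < v\<close>
      by (simp add: log_laplace_def ln_ext_def flip: I_def)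
  qed
qed

section \<open>The tail of the Cramer transform\<close>

text \<open>Write \<open>x\<close> as the combination of \<open>y\<close> in \<open>K\<close> and
  \<open>b\<close> in the small cube. If the form at \<open>b\<close> is not far below that at
  \<open>x\<close>, then \<open>x\<close> is at height at most \<delta> times the l1 norm of \<xi>,
  and a deep half-space is contained. Otherwise \<open>y\<close> must compensate for
  \<open>b\<close> and exceeds \<open>x\<close> by enough for its whole \<open>r\<close>-cube to lie
  in the half-space.\<close>

lemma halfspace_mink_comb:
  assumes deep: "\<And>\<xi>. \<delta> \<le> prob {z \<in> space \<mu>. \<delta> * (\<Sum>i<n. \<bar>\<xi> i\<bar>) \<le> ip n z \<xi>}"
    and heavy: "\<And>z. z \<in> K \<Longrightarrow> \<eta> \<le> prob (cube n z r)"
    and t: "0 < t" "t < 1" and r: "0 \<le> r" "r \<le> (1 - t) * s" "2 * s \<le> \<delta>"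
    and x: "x \<in> mink_comb n t K (cube n (\<lambda>_. 0) s)"
  shows "min \<delta> \<eta> \<le> prob {z \<in> space \<mu>. ip n x \<xi> \<le> ip n z \<xi>}"
proof -
  define L where "L = (\<Sum>i<n. \<bar>\<xi> i\<bar>)"
  have L: "0 \<le> L" by (simp add: L_def sum_nonneg)
  obtain y b where y: "y \<in> K" and b: "b \<in> cube n (\<lambda>_. 0) s"
    and x: "x = (\<lambda>i\<in>{..<n}. t * y i + (1 - t) * b i)"
    using x by (auto simp: mink_comb_def)
  have ipx: "ip n x \<xi> = t * ip n y \<xi> + (1 - t) * ip n b \<xi>" unfolding x by (rule ip_linear)
  have ipb: "ip n b \<xi> \<le> s * L" using ip_cube_bound[OF b, of \<xi>] by (simp add: ip_def L_def)
  have sL: "2 * s * L \<le> \<delta> * L" using r(3) L by (rule mult_right_mono)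
  show ?thesis
  proof (cases "ip n x \<xi> - s * L \<le> ip n b \<xi>")
    case True
    then have "ip n x \<xi> \<le> \<delta> * L" using ipb sL by linarith
    then have "prob {z \<in> space \<mu>. \<delta> * L \<le> ip n z \<xi>} \<le> prob {z \<in> space \<mu>. ip n x \<xi> \<le> ip n z \<xi>}"
      by (intro finite_measure_mono) auto
    then show ?thesis using deep[of \<xi>] by (simp add: L_def)
  next
    case False
    then have "(1 - t) * ip n b \<xi> \<le> (1 - t) * (ip n x \<xi> - s * L)"
      using t by (intro mult_left_mono) auto
    moreover have "(1 - t) * (ip n x \<xi> - s * L) = ip n x \<xi> - t * ip n x \<xi> - (1 - t) * s * L"
      by (simp add: algebra_simps)
    ultimately have "t * ip n x \<xi> + (1 - t) * s * L \<le> t * ip n y \<xi>"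
      using ipx by linarith
    moreover have "r * L \<le> (1 - t) * s * L" using r(2) L by (rule mult_right_mono)
    moreover have "t * (r * L) \<le> r * L" using t r(1) L by (intro mult_left_le_one_le) auto
    ultimately have "t * (ip n x \<xi> + r * L) \<le> t * ip n y \<xi>" by (simp add: algebra_simps)
    then have ipy: "ip n x \<xi> + r * L \<le> ip n y \<xi>" using t by simp
    have "cube n y r \<subseteq> {z \<in> space \<mu>. ip n x \<xi> \<le> ip n z \<xi>}"
    proof
      fix z assume z: "z \<in> cube n y r"
      have "ip n y \<xi> - ip n z \<xi> \<le> r * L"
        using ip_cube_bound[OF z, of \<xi>] by (simp add: L_def)
      then show "z \<in> {z \<in> space \<mu>. ip n x \<xi> \<le> ip n z \<xi>}"
        using z cube_subset_vecs ipy by (auto simp: space_mu)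
    qed
    then have "prob (cube n y r) \<le> prob {z \<in> space \<mu>. ip n x \<xi> \<le> ip n z \<xi>}"
      by (intro finite_measure_mono) auto
    then show ?thesis using heavy[OF y] by simp
  qed
qed

text \<open>Only the rate has to be uniform: each increase of the level by
  \<open>(2 * n + 1) * ln 2\<close> halves the bound. The factor \<open>C\<close> may depend on
  \<open>n\<close> and \<mu>.\<close>

lemma cramer_tail:
  obtains C where "0 \<le> C"
    "\<And>k::nat. prob {x \<in> space \<mu>. ereal (real k * (real (2 * n + 1) * ln 2)) < cramer n \<mu> x} \<le> C * (1/2) ^ k"
proof -
  obtain \<delta> where \<delta>: "0 < \<delta>"
    and deep: "\<And>\<xi>. \<delta> \<le> prob {z \<in> space \<mu>. \<delta> * (\<Sum>i<n. \<bar>\<xi> i\<bar>) \<le> ip n z \<xi>}"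
    using deep_origin by blast
  define s where "s = \<delta> / 2"
  define \<beta> where "\<beta> = prob (cube n (\<lambda>_. 0) s)"
  have s: "0 < s" using \<delta> by (simp add: s_def)
  have \<beta>: "0 < \<beta>" "\<beta> \<le> 1" using heavy_origin[OF s] by (auto simp: \<beta>_def)
  obtain k0 where k0: "(1/2) ^ k0 < s" using real_arch_pow_inv[OF s, of "1/2"] by auto
  \<comment> \<open>The summands pay for Markov's inequality, the discarded cells, the loss in
    log-concavity, and the trivial bound for \<open>k < k0\<close>.\<close>
  define C where "C = l1_mean + 3 ^ n + (- ln \<beta>) / s + 2 ^ k0"
  define T where "T k = {x \<in> space \<mu>. ereal (real k * (real (2 * n + 1) * ln 2)) < cramer n \<mu> x}" for k :: nat
  have Ts: "T k \<in> sets \<mu>" for k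
    unfolding T_def using cramer_measurable by measurable
  have C: "l1_mean + 3 ^ n + (- ln \<beta>) / s \<le> C" "2 ^ k0 \<le> C"
  proof -
    have "0 \<le> (- ln \<beta>) / s" using \<beta> s by (intro divide_nonneg_pos) auto
    moreover have "0 \<le> (3::real) ^ n" by simp
    ultimately show "2 ^ k0 \<le> C" using l1_mean_nonneg unfolding C_def by linarith
  qed (simp add: C_def)
  have C0: "0 \<le> C" using C(2) by (rule order_trans[rotated]) simp
  show ?thesis
  proof (rule that[OF C0])
    fix k :: nat
    define r :: real where "r = (1/2) ^ k"
    have r: "0 < r" "r \<le> 1" by (simp_all add: r_def power_le_one)
    show "prob {x \<in> space \<mu>. ereal (real k * (real (2 * n + 1) * ln 2)) < cramer n \<mu> x} \<le> C * (1/2) ^ k"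
    proof (cases "k0 \<le> k")
      case False
      have "1 = (2::real) ^ k0 * (1/2) ^ k0" by (simp flip: power_mult_distrib)
      also have "\<dots> \<le> C * (1/2) ^ k"
        using False C(2) C0 by (intro mult_mono power_decreasing) auto
      finally show ?thesis by (rule order_trans[OF prob_le_1])
    next
      case True
      have rs: "r < s" using power_decreasing[OF True, of "1/2::real"] unfolding r_def
        by (intro le_less_trans[OF _ k0]) simp
      \<comment> \<open>Chosen so that \<open>(1 - t) * s = r\<close>, as
        \<open>halfspace_mink_comb\<close> demands; \<open>k0 \<le> k\<close> ensures
        \<open>0 < t\<close>.\<close>
      define t where "t = 1 - r / s"
      have t: "0 < t" "t < 1" using r rs s by (auto simp: t_def)
      \<comment> \<open>At most \<open>(3 / r\<^sup>2) ^ n\<close> cells are discarded below, so the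
        exponent \<open>2 * n + 1\<close> keeps the loss linear in \<open>r\<close>.\<close>
      define \<eta> where "\<eta> = r ^ (2 * n + 1)"
      have \<eta>: "0 < \<eta>" using r by (simp add: \<eta>_def)
      obtain K where K: "compactin (powertop_real {..<n}) K" "K \<in> sets \<mu>"
        "\<And>z. z \<in> K \<Longrightarrow> \<eta> \<le> prob (cube n z r)"
        "prob (cube n (\<lambda>_. 0) (real (4 ^ k) * r)) - real (2 * 4 ^ k + 1) ^ n * \<eta> \<le> prob K"
        using heavy_compact[OF r(1) less_imp_le[OF \<eta>], of "4 ^ k"] by metis
      have r4: "4 ^ k * r\<^sup>2 = 1"
      proof -
        have "4 ^ k * r\<^sup>2 = (4 * ((1/2) * (1/2))) ^ k"
          by (simp only: r_def power_mult_distrib power2_eq_square)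
        then show ?thesis by simp
      qed
      have probK: "1 - (l1_mean + 3 ^ n) * r \<le> prob K"
      proof -
        have R: "real (4 ^ k) * r = 1 / r" using r4 r by (simp add: field_simps power2_eq_square)
        have "real (2 * 4 ^ k + 1) ^ n * \<eta> \<le> (3 * 4 ^ k) ^ n * \<eta>"
          using \<eta> by (intro mult_right_mono power_mono) auto
        also have "\<dots> = 3 ^ n * (4 ^ k * r\<^sup>2) ^ n * r"
          by (simp add: \<eta>_def power_mult_distrib power_mult)
        finally have "real (2 * 4 ^ k + 1) ^ n * \<eta> \<le> 3 ^ n * r" by (simp add: r4)
        moreover have "1 - l1_mean * r \<le> prob (cube n (\<lambda>_. 0) (real (4 ^ k) * r))"
          unfolding R using prob_cube_ge[of "1 / r"] r by simp
        ultimately show ?thesis using K(4) by (simp add: algebra_simps)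
      qed
      define M where "M = mink_comb n t K (cube n (\<lambda>_. 0) s)"
      have "1 - C * r \<le> prob M"
      proof -
        \<comment> \<open>Both powers are linearised: a number in [0, 1] only grows under the
          exponent \<open>t \<le> 1\<close>, and the exponential lies above its tangent. The loss
          from the small cube is thus of order \<open>r\<close>.\<close>
        have K_powr: "prob K \<le> prob K powr t"
          using powr_mono'[of t 1 "prob K"] t by (simp add: powr_one)
        have \<beta>_powr: "1 + (r / s) * ln \<beta> \<le> \<beta> powr (1 - t)"
          using exp_ge_add_one_self[of "(r / s) * ln \<beta>"] \<beta> by (simp add: powr_def t_def)
        have "prob K powr t * \<beta> powr (1 - t) \<le> prob M"
          unfolding M_def \<beta>_def using t K(1) by (intro measure_mink_comb compactin_cube)
        moreover have "prob K + (r / s) * ln \<beta> \<le> prob K * (1 + (r / s) * ln \<beta>)"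
        proof -
          have "(r / s) * ln \<beta> \<le> 0" using r s \<beta> by (intro mult_nonneg_nonpos) auto
          then have "1 * ((r / s) * ln \<beta>) \<le> prob K * ((r / s) * ln \<beta>)"
            by (intro mult_right_mono_neg) auto
          then show ?thesis by (simp add: algebra_simps)
        qed
        moreover have "prob K * (1 + (r / s) * ln \<beta>) \<le> prob K powr t * \<beta> powr (1 - t)"
        proof -
          have "prob K * (1 + (r / s) * ln \<beta>) \<le> prob K * \<beta> powr (1 - t)"
            using \<beta>_powr by (intro mult_left_mono) auto
          also have "\<dots> \<le> prob K powr t * \<beta> powr (1 - t)"
            using K_powr by (intro mult_right_mono) auto
          finally show ?thesis .
        qed
        ultimately have "prob K + (r / s) * ln \<beta> \<le> prob M" by linarith
        moreover have "(l1_mean + 3 ^ n + (- ln \<beta>) / s) * r \<le> C * r"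
          using C(1) r by (intro mult_right_mono) auto
        ultimately show ?thesis using probK by (simp add: algebra_simps)
      qed
      moreover have "M \<inter> T k = {}"
      proof (intro equals0I, elim IntE)
        fix x assume x: "x \<in> M" "x \<in> T k"
        have "\<eta> \<le> r ^ 1" unfolding \<eta>_def using r by (intro power_decreasing) auto
        then have min: "min \<delta> \<eta> = \<eta>" using rs \<delta> by (simp add: s_def)
        have "cramer n \<mu> x \<le> ereal (- ln \<eta>)"
        proof (rule cramer_le[OF \<eta>])
          show "\<eta> \<le> prob {z \<in> space \<mu>. ip n x \<xi> \<le> ip n z \<xi>}" for \<xi>
            using halfspace_mink_comb[OF deep K(3) t less_imp_le[OF r(1)], where s = s and x = x and \<xi> = \<xi>] x s
            unfolding min M_def by (simp add: t_def s_def)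
        qed
        also have "- ln \<eta> = real k * (real (2 * n + 1) * ln 2)"
        proof -
          have "ln \<eta> = real (2 * n + 1) * ln r" unfolding \<eta>_def using r by (intro ln_realpow)
          moreover have "ln r = real k * (- ln 2)"
            unfolding r_def by (subst ln_realpow) (simp_all add: ln_div)
          ultimately show ?thesis by simp
        qed
        finally show False using x(2) unfolding T_def mem_Collect_eq using leD by blast
      qed
      \<comment> \<open>If \<open>M\<close> were not measurable, its measure would be 0 and the bound trivial.\<close>
      ultimately have "prob (T k) \<le> C * r"
      proof (cases "M \<in> sets \<mu>")
        case True
        then have "T k \<subseteq> space \<mu> - M" using \<open>M \<inter> T k = {}\<close> by (auto simp: T_def)
        then have "prob (T k) \<le> prob (space \<mu> - M)"
          using True by (intro finite_measure_mono) auto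
        then show ?thesis using \<open>1 - C * r \<le> prob M\<close> True by (simp add: prob_compl)
      next
        case False
        then have "1 \<le> C * r" using \<open>1 - C * r \<le> prob M\<close> by (simp add: measure_notin_sets)
        then show ?thesis using prob_le_1[of "T k"] by linarith
      qed
      then show ?thesis by (simp add: T_def r_def)
    qed
  qed
qed

section \<open>From the tail to moments\<close>

text \<open>A positive finite value lies in exactly one interval \<open>(k * a, Suc k * a]\<close>,
  and the term of that \<open>k\<close> dominates. The summand 1 covers the value 0. At an infinite
  value every term is at least 1, so the series diverges as well.\<close>

lemma exp_ext_cramer_le:
  assumes a: "0 < a" and b: "0 < b" and x: "x \<in> space \<mu>"
  shows "exp_ext (ereal b * cramer n \<mu> x) \<le>
    1 + (\<Sum>k. ennreal (exp (b * (real (Suc k) * a))) *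
      indicator {x \<in> space \<mu>. ereal (real k * a) < cramer n \<mu> x} x)"
    (is "_ \<le> 1 + (\<Sum>k. ?f k)")
proof (cases "cramer n \<mu> x")
  case (real y)
  have y: "0 \<le> y" using cramer_nonneg[of x] real by simp
  show ?thesis
  proof (cases "y = 0")
    case True
    then show ?thesis using real by (simp add: exp_ext_def)
  next
    case False
    then have "0 < y / a" using y a by simp
    then have "0 < \<lceil>y / a\<rceil>" by simp
    then obtain k where k: "\<lceil>y / a\<rceil> = int (Suc k)" by (metis zero_less_imp_eq_int gr0_conv_Suc)
    then have "real k < y / a" "y / a \<le> real (Suc k)" by linarith+
    then have *: "real k * a < y" "y \<le> real (Suc k) * a"
      using a by (simp_all add: pos_less_divide_eq pos_divide_le_eq)
    have "exp_ext (ereal b * cramer n \<mu> x) = ennreal (exp (b * y))"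
      using real by (simp add: exp_ext_def)
    also have "\<dots> \<le> ?f k" using * b real x by (auto simp: intro!: ennreal_leI mult_left_mono)
    also have "\<dots> \<le> (\<Sum>k. ?f k)" 
    proof -
      have "g k \<le> (\<Sum>k. g k)" for g :: "nat \<Rightarrow> ennreal"
        using sum_le_suminf[of g "{k}"] by simp
      then show ?thesis .
    qed
    also have "\<dots> \<le> 1 + (\<Sum>k. ?f k)" by simp
    finally show ?thesis .
  qed
next
  case PInf
  have "of_nat m \<le> (\<Sum>k. ?f k)" for m
  proof -
    have "of_nat m = (\<Sum>k<m. 1::ennreal)" by simp
    also have "\<dots> \<le> (\<Sum>k<m. ?f k)"
      using PInf x a b by (intro sum_mono) (auto simp: ennreal_ge_1)
    also have "\<dots> \<le> (\<Sum>k. ?f k)" by (intro sum_le_suminf) auto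
    finally show ?thesis .
  qed
  then have "\<not> (\<Sum>k. ?f k) < top" using ennreal_Ex_less_of_nat leD by blast
  then show ?thesis by (simp add: less_top[symmetric])
next
  case MInf
  then show ?thesis using cramer_nonneg[of x] by simp
qed

text \<open>As \<open>2 * n + 1 \<le> 3 * n\<close>, the constant 1/6 makes each level cost at most
  a factor sqrt 2 in the exponential, while the tail gains 1/2. A geometric series with ratio
  \<theta> = 1 / sqrt 2 remains.\<close>

lemma exp_moment:
  "(\<integral>\<^sup>+ x. exp_ext (ereal (1 / 6 / real n) * cramer n \<mu> x) \<partial>\<mu>) < \<infinity>"
proof -
  define a where "a = real (2 * n + 1) * ln 2"
  define b where "b = 1 / 6 / real n"
  define T where "T k = {x \<in> space \<mu>. ereal (real k * a) < cramer n \<mu> x}" for k :: nat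
  define \<theta> :: real where "\<theta> = exp (- ln 2 / 2)"
  have [measurable]: "T k \<in> sets \<mu>" for k
    unfolding T_def using cramer_measurable by measurable
  obtain C where C: "0 \<le> C" "\<And>k. prob (T k) \<le> C * (1/2) ^ k"
    using cramer_tail unfolding T_def a_def by metis
  have a: "0 < a" by (simp add: a_def)
  have b: "0 < b" using n_pos by (simp add: b_def)
  have "real (2 * n + 1) \<le> 3 * real n" using n_pos by simp
  then have "b * a \<le> b * (3 * real n * ln 2)" unfolding a_def using b by (intro mult_left_mono mult_right_mono) auto
  also have "\<dots> = ln 2 / 2" using n_pos by (simp add: b_def)
  finally have ba: "b * a \<le> ln 2 / 2" .
  have term_le: "exp (b * (real (Suc k) * a)) * prob (T k) \<le> exp (ln 2 / 2) * C * \<theta> ^ k" for k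
  proof -
    have "real (Suc k) * (b * a) \<le> real (Suc k) * (ln 2 / 2)"
      using ba by (intro mult_left_mono) auto
    then have "exp (b * (real (Suc k) * a)) \<le> exp (real (Suc k) * (ln 2 / 2))"
      by (simp add: mult_ac)
    then have "exp (b * (real (Suc k) * a)) * prob (T k) \<le> exp (real (Suc k) * (ln 2 / 2)) * (C * (1/2) ^ k)"
      using C by (intro mult_mono) auto
    also have "(1/2::real) ^ k = exp (- ln 2) ^ k" by (simp add: exp_minus inverse_eq_divide)
    also have "exp (real (Suc k) * (ln 2 / 2)) * (C * exp (- ln 2) ^ k) =
        C * (exp (real (Suc k) * (ln 2 / 2)) * exp (- ln 2) ^ k)"
      by (simp only: mult_ac)
    also have "exp (real (Suc k) * (ln 2 / 2)) * exp (- ln 2) ^ k = exp (ln 2 / 2) * \<theta> ^ k"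
      unfolding \<theta>_def exp_of_nat_mult[symmetric] exp_add[symmetric] by (simp add: field_simps)
    also have "C * (exp (ln 2 / 2) * \<theta> ^ k) = exp (ln 2 / 2) * C * \<theta> ^ k"
      by (simp only: mult_ac)
    finally show ?thesis .
  qed
  have "(\<integral>\<^sup>+ x. exp_ext (ereal b * cramer n \<mu> x) \<partial>\<mu>) \<le>
      (\<integral>\<^sup>+ x. 1 + (\<Sum>k. ennreal (exp (b * (real (Suc k) * a))) * indicator (T k) x) \<partial>\<mu>)"
    unfolding T_def using a b by (intro nn_integral_mono exp_ext_cramer_le)
  also have "\<dots> = 1 + (\<Sum>k. ennreal (exp (b * (real (Suc k) * a))) * emeasure \<mu> (T k))"
    by (simp add: nn_integral_add nn_integral_suminf nn_integral_cmult_indicator emeasure_space_1)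
  also have "\<dots> \<le> 1 + (\<Sum>k. ennreal (exp (ln 2 / 2) * C * \<theta> ^ k))"
    using term_le by (intro add_left_mono suminf_le)
      (auto simp: emeasure_eq_measure ennreal_mult'[symmetric] intro!: ennreal_leI)
  also have "\<dots> < \<infinity>"
  proof -
    have "summable (\<lambda>k. exp (ln 2 / 2) * C * \<theta> ^ k)"
      by (intro summable_mult summable_geometric) (simp add: \<theta>_def)
    then have "(\<Sum>k. ennreal (exp (ln 2 / 2) * C * \<theta> ^ k)) \<noteq> top"
      using C by (intro ennreal_suminf_neq_top) (auto simp: \<theta>_def)
    then show ?thesis by (simp add: less_top)
  qed
  finally show ?thesis by (simp add: b_def)
qed

text \<open>Raise \<open>u \<le> exp u\<close> with \<open>u = b * v / p\<close> to the power
  \<open>p\<close>.\<close>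

lemma powr_ext_le_exp_ext:
  assumes "0 \<le> y" "0 < p" "0 < b"
  shows "powr_ext (e2ennreal \<bar>y\<bar>) p \<le> ennreal ((p / b) powr p) * exp_ext (ereal b * y)"
proof (cases y)
  case (real v)
  have v: "0 \<le> v" using assms real by simp
  have "v = (p / b) * (b * v / p)" using assms by simp
  also have "\<dots> \<le> (p / b) * exp (b * v / p)"
  proof (rule mult_left_mono)
    show "b * v / p \<le> exp (b * v / p)" using exp_ge_add_one_self[of "b * v / p"] by linarith
  qed (use assms in simp)
  finally have "v powr p \<le> ((p / b) * exp (b * v / p)) powr p"
    using assms v by (intro powr_mono2) auto
  also have "\<dots> = (p / b) powr p * exp (b * v)"
    using assms by (subst powr_mult) (auto simp: exp_powr_real)
  finally show ?thesis
    using real v by (simp add: powr_ext_def exp_ext_def e2ennreal_ereal ennreal_mult'[symmetric] ennreal_leI)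
next
  case PInf
  then show ?thesis using assms by (simp add: exp_ext_def ennreal_mult_eq_top_iff)
next
  case MInf
  then show ?thesis using assms by simp
qed

lemma polynomial_moment:
  assumes "0 < p"
  shows "(\<integral>\<^sup>+ x. powr_ext (e2ennreal \<bar>cramer n \<mu> x\<bar>) p \<partial>\<mu>) < \<infinity>"
proof -
  define b where "b = 1 / 6 / real n"
  have b: "0 < b" using n_pos by (simp add: b_def)
  have [measurable]: "cramer n \<mu> \<in> borel_measurable \<mu>" by (rule cramer_measurable)
  have "(\<lambda>x. exp_ext (ereal b * cramer n \<mu> x)) \<in> borel_measurable \<mu>"
    unfolding exp_ext_def by measurable
  then have "(\<integral>\<^sup>+ x. ennreal ((p / b) powr p) * exp_ext (ereal b * cramer n \<mu> x) \<partial>\<mu>) =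
      ennreal ((p / b) powr p) * (\<integral>\<^sup>+ x. exp_ext (ereal b * cramer n \<mu> x) \<partial>\<mu>)"
    by (rule nn_integral_cmult)
  also have "\<dots> < \<infinity>"
    using exp_moment unfolding b_def by (auto simp: ennreal_mult_less_top)
  finally show ?thesis
    using assms b cramer_nonneg
    by (elim le_less_trans[rotated]) (intro nn_integral_mono powr_ext_le_exp_ext)
qed

end

theorem theorem1p1:
  shows "\<exists>c::real. c > 0 \<and>
    (\<forall>(n::nat) (\<mu>::(nat \<Rightarrow> real) measure). n \<ge> 1 \<longrightarrow> log_concave n \<mu> \<longrightarrow> centered n \<mu> \<longrightarrow>
       cramer n \<mu> \<in> borel_measurable \<mu> \<and>
       (\<integral>\<^sup>+ x. exp_ext (ereal (c / real n) * cramer n \<mu> x) \<partial>\<mu>) < \<infinity> \<and>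
       (\<forall>p::real. p > 0 \<longrightarrow> (\<integral>\<^sup>+ x. powr_ext (e2ennreal \<bar>cramer n \<mu> x\<bar>) p \<partial>\<mu>) < \<infinity>))"
proof (intro exI[of _ "1/6"] conjI allI impI)
  fix n :: nat and \<mu> :: "(nat \<Rightarrow> real) measure"
  assume "n \<ge> 1" "log_concave n \<mu>" "centered n \<mu>"
  then interpret centered_log_concave n \<mu> by unfold_locales
  show "cramer n \<mu> \<in> borel_measurable \<mu>" by (rule cramer_measurable)
  show "(\<integral>\<^sup>+ x. exp_ext (ereal (1/6 / real n) * cramer n \<mu> x) \<partial>\<mu>) < \<infinity>" by (rule exp_moment)
  show "(\<integral>\<^sup>+ x. powr_ext (e2ennreal \<bar>cramer n \<mu> x\<bar>) p \<partial>\<mu>) < \<infinity>" if "p > 0" for p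
    using that by (rule polynomial_moment)
qed simp

end
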